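(* Let $p\ge1$ be an integer, let $\alpha,\beta\ge 0$ be real numbers, and let $\nu_1,\nu_2$ be positive rational numbers. Let $f^{p,\alpha,\beta}:[-\pi,\pi]^2\to\mathbb{C}^{2\times2}$ be the Hermitian matrix-valued function defined in the context, with eigenvalue functions $\lambda_1(f^{p,\alpha,\beta})$ and $\lambda_2(f^{p,\alpha,\beta})$ (the smaller and the larger eigenvalue, respectively), and let $\mathfrak{L}_p$ be the 2D Laplacian symbol defined in the context. Then, for all $(\theta_1,\theta_2)\in[-\pi,\pi]^2$, $$0\le\min(\alpha,\beta)\,\mathfrak{L}_p(\theta_1,\theta_2)\le\lambda_1(f^{p,\alpha,\beta}(\theta_1,\theta_2))\le\lambda_2(f^{p,\alpha,\beta}(\theta_1,\theta_2))\le\max(\alpha,\beta)\,\mathfrak{L}_p(\theta_1,\theta_2).$$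
   Context: **Cardinal B-splines.** $\phi_0(t)=1$ for $t\in[0,1)$ and $0$ otherwise; for $p\ge1$, $\phi_p(t)=\frac{t}{p}\phi_{p-1}(t)+\frac{p+1-t}{p}\phi_{p-1}(t-1)$. **Univariate symbols.** For $\theta\in[-\pi,\pi]$, $$\mathfrak{m}_p(\theta)=\phi_{2p+1}(p+1)+2\sum_{k=1}^p\phi_{2p+1}(p+1-k)\cos(k\theta),$$ $$\mathfrak{a}_p(\theta)=-2\sum_{k=1}^p\phi_{2p+1}'(p+1-k)\sin(k\theta),$$ $$\mathfrak{s}_p(\theta)=-\phi_{2p+1}''(p+1)-2\sum_{k=1}^p\phi_{2p+1}''(p+1-k)\cos(k\theta).$$ **2D symbol.** $f^{p,\alpha,\beta}=[f^{p,\alpha,\beta}_{i,j}]_{i,j=1}^2$ with $$f^{p,\alpha,\beta}_{1,1}(\theta_1,\theta_2)=\alpha\frac{\nu_2}{\nu_1}\mathfrak{m}_p(\theta_1)\mathfrak{s}_p(\theta_2)+\beta\frac{\nu_1}{\nu_2}\mathfrak{s}_p(\theta_1)\mathfrak{m}_p(\theta_2),$$ $$f^{p,\alpha,\beta}_{1,2}(\theta_1,\theta_2)=f^{p,\alpha,\beta}_{2,1}(\theta_1,\theta_2)=-(\alpha-\beta)\,\mathfrak{a}_p(\theta_1)\mathfrak{a}_p(\theta_2),$$ $$f^{p,\alpha,\beta}_{2,2}(\theta_1,\theta_2)=\alpha\frac{\nu_1}{\nu_2}\mathfrak{s}_p(\theta_1)\mathfrak{m}_p(\theta_2)+\beta\frac{\nu_2}{\nu_1}\mathfrak{m}_p(\theta_1)\mathfrak{s}_p(\theta_2).$$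 **2D Laplacian symbol.** $$\mathfrak{L}_p(\theta_1,\theta_2)=\frac{\nu_2}{\nu_1}\mathfrak{m}_p(\theta_1)\mathfrak{s}_p(\theta_2)+\frac{\nu_1}{\nu_2}\mathfrak{s}_p(\theta_1)\mathfrak{m}_p(\theta_2).$$ *)

theory Defs
  imports "HOL-Analysis.Analysis" "Jordan_Normal_Form.Spectral_Radius"
begin

primrec bspline :: "nat \<Rightarrow> real \<Rightarrow> real" where
  "bspline 0 t = (if 0 \<le> t \<and> t < 1 then 1 else 0)"
| "bspline (Suc p) t =
     t / real (Suc p) * bspline p t
     + (real (Suc p) + 1 - t) / real (Suc p) * bspline p (t - 1)"

text \<open>
  For \<open>p \<ge> 1\<close> the spline \<open>bspline (2 * p + 1)\<close> is twice continuously differentiable, so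
  \<open>deriv\<close> below is always taken of a differentiable function; for \<open>p = 0\<close> (linear splines) the derivatives
  do not exist at the knots and \<open>sym_s 0\<close> has no meaning.
\<close>

definition sym_m :: "nat \<Rightarrow> real \<Rightarrow> real" where
  "sym_m p \<theta> = bspline (2 * p + 1) (real p + 1)
     + 2 * (\<Sum>k = 1..p. bspline (2 * p + 1) (real p + 1 - real k) * cos (real k * \<theta>))"

definition sym_a :: "nat \<Rightarrow> real \<Rightarrow> real" where
  "sym_a p \<theta> =
     - 2 * (\<Sum>k = 1..p. deriv (bspline (2 * p + 1)) (real p + 1 - real k) * sin (real k * \<theta>))"

definition sym_s :: "nat \<Rightarrow> real \<Rightarrow> real" where
  "sym_s p \<theta> = - deriv (deriv (bspline (2 * p + 1))) (real p + 1)
     - 2 * (\<Sum>k = 1..p. deriv (deriv (bspline (2 * p + 1))) (real p + 1 - real k)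
                        * cos (real k * \<theta>))"

text \<open>The parameters \<open>\<nu>1\<close>, \<open>\<nu>2\<close>, implicit in the usual notation, are explicit arguments.\<close>

definition sym_f11 :: "real \<Rightarrow> real \<Rightarrow> nat \<Rightarrow> real \<Rightarrow> real \<Rightarrow> real \<Rightarrow> real \<Rightarrow> real" where
  "sym_f11 \<nu>1 \<nu>2 p \<alpha> \<beta> \<theta>1 \<theta>2 =
     \<alpha> * (\<nu>2 / \<nu>1) * sym_m p \<theta>1 * sym_s p \<theta>2 + \<beta> * (\<nu>1 / \<nu>2) * sym_s p \<theta>1 * sym_m p \<theta>2"

definition sym_f12 :: "nat \<Rightarrow> real \<Rightarrow> real \<Rightarrow> real \<Rightarrow> real \<Rightarrow> real" where
  "sym_f12 p \<alpha> \<beta> \<theta>1 \<theta>2 = - (\<alpha> - \<beta>) * sym_a p \<theta>1 * sym_a p \<theta>2"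

definition sym_f22 :: "real \<Rightarrow> real \<Rightarrow> nat \<Rightarrow> real \<Rightarrow> real \<Rightarrow> real \<Rightarrow> real \<Rightarrow> real" where
  "sym_f22 \<nu>1 \<nu>2 p \<alpha> \<beta> \<theta>1 \<theta>2 =
     \<alpha> * (\<nu>1 / \<nu>2) * sym_s p \<theta>1 * sym_m p \<theta>2 + \<beta> * (\<nu>2 / \<nu>1) * sym_m p \<theta>1 * sym_s p \<theta>2"

definition sym_f :: "real \<Rightarrow> real \<Rightarrow> nat \<Rightarrow> real \<Rightarrow> real \<Rightarrow> real \<Rightarrow> real \<Rightarrow> complex mat" where
  "sym_f \<nu>1 \<nu>2 p \<alpha> \<beta> \<theta>1 \<theta>2 = mat_of_rows_list 2
     [[complex_of_real (sym_f11 \<nu>1 \<nu>2 p \<alpha> \<beta> \<theta>1 \<theta>2), complex_of_real (sym_f12 p \<alpha> \<beta> \<theta>1 \<theta>2)],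
      [complex_of_real (sym_f12 p \<alpha> \<beta> \<theta>1 \<theta>2), complex_of_real (sym_f22 \<nu>1 \<nu>2 p \<alpha> \<beta> \<theta>1 \<theta>2)]]"

definition laplace_sym :: "real \<Rightarrow> real \<Rightarrow> nat \<Rightarrow> real \<Rightarrow> real \<Rightarrow> real" where
  "laplace_sym \<nu>1 \<nu>2 p \<theta>1 \<theta>2 =
     \<nu>2 / \<nu>1 * sym_m p \<theta>1 * sym_s p \<theta>2 + \<nu>1 / \<nu>2 * sym_s p \<theta>1 * sym_m p \<theta>2"

text \<open>
  Smallest and largest eigenvalue, meant for Hermitian matrices of positive dimension: there all
  eigenvalues are real, and the set below is finite and nonempty.
\<close>

definition real_eigenvalues :: "complex mat \<Rightarrow> real set" where
  "real_eigenvalues A = {x. eigenvalue A (complex_of_real x)}"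

definition eig_min :: "complex mat \<Rightarrow> real" where
  "eig_min A = Min (real_eigenvalues A)"

definition eig_max :: "complex mat \<Rightarrow> real" where
  "eig_max A = Max (real_eigenvalues A)"

lemma sym_f_carrier: "sym_f \<nu>1 \<nu>2 p \<alpha> \<beta> \<theta>1 \<theta>2 \<in> carrier_mat 2 2"
  by (auto simp: sym_f_def mat_of_rows_list_def)

lemma sym_f_hermitian: "mat_adjoint (sym_f \<nu>1 \<nu>2 p \<alpha> \<beta> \<theta>1 \<theta>2) = sym_f \<nu>1 \<nu>2 p \<alpha> \<beta> \<theta>1 \<theta>2"
  by (rule eq_matI)
     (auto simp: sym_f_def mat_of_rows_list_def mat_adjoint_def mat_of_rows_index
       numeral_2_eq_2 less_Suc_eq)

lemma det_mat_2:
  fixes A :: "'a :: comm_ring_1 mat"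
  assumes A: "A \<in> carrier_mat 2 2"
  shows "Determinant.det A = A $$ (0,0) * A $$ (1,1) - A $$ (0,1) * A $$ (1,0)"
proof -
  have "Determinant.det (mat_delete A 0 j) = mat_delete A 0 j $$ (0,0)" if "j < 2" for j
    using mat_delete_carrier[OF A, of 0 j] by (intro det_single) auto
  then show ?thesis
    using A by (subst laplace_expansion_row[OF A, of 0])
      (auto simp: numeral_2_eq_2 cofactor_def mat_delete_def)
qed

text \<open>
  On the symbol, \<open>eig_min\<close> and \<open>eig_max\<close> are the two eigenvalues counted with multiplicity.
\<close>

lemma char_poly_sym_f:
  fixes \<nu>1 \<nu>2 \<alpha> \<beta> \<theta>1 \<theta>2 :: real and p :: nat
  defines "A \<equiv> sym_f \<nu>1 \<nu>2 p \<alpha> \<beta> \<theta>1 \<theta>2"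
  shows "char_poly A = [:- complex_of_real (eig_min A), 1:] * [:- complex_of_real (eig_max A), 1:]"
proof -
  define a b d where "a = sym_f11 \<nu>1 \<nu>2 p \<alpha> \<beta> \<theta>1 \<theta>2"
    and "b = sym_f12 p \<alpha> \<beta> \<theta>1 \<theta>2" and "d = sym_f22 \<nu>1 \<nu>2 p \<alpha> \<beta> \<theta>1 \<theta>2"
  define D where "D = sqrt ((a - d)\<^sup>2 + 4 * b\<^sup>2)"
  define r s where "r = (a + d - D) / 2" and "s = (a + d + D) / 2"
  have D: "D \<ge> 0" "D * D = (a - d)\<^sup>2 + 4 * b\<^sup>2"
    by (simp_all add: D_def)
  have rs: "r \<le> s" "r + s = a + d" "r * s = a * d - b * b"
    using D by (auto simp: r_def s_def field_simps power2_eq_square)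
  have A: "A \<in> carrier_mat 2 2"
    unfolding A_def by (rule sym_f_carrier)
  have "char_poly A = [:of_real (a * d - b * b), - of_real (a + d), 1:]"
    using A unfolding char_poly_defs A_def sym_f_def a_def[symmetric] b_def[symmetric] d_def[symmetric]
    by (subst det_mat_2) (auto simp: mat_of_rows_list_def)
  also have "\<dots> = [:- complex_of_real r, 1:] * [:- complex_of_real s, 1:]"
    unfolding rs(2,3)[symmetric] by simp
  finally have cp: "char_poly A = [:- complex_of_real r, 1:] * [:- complex_of_real s, 1:]" .
  have "real_eigenvalues A = {r, s}"
    unfolding real_eigenvalues_def eigenvalue_root_char_poly[OF A] cp poly_mult by (auto simp del: mult_pCons_left mult_pCons_right)
  then show ?thesis
    using rs(1) cp by (simp add: eig_min_def eig_max_def)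
qed

end

theory Submission
  imports Defs
begin

text \<open>
  Everything rests on the inequality \<open>a\<^sup>2 \<le> m * s\<close>, with \<open>m, s \<ge> 0\<close>, for the univariate symbols.
  With \<open>\<theta> = 2 * pi * x\<close> and \<open>z = cis \<theta>\<close>, the recurrence of the B-splines at the integers says that
  \<open>G n = (\<Sum>k\<le>n. bspline n k * z ^ k) / (1 - z) ^ (n + 1)\<close> satisfies \<open>n * G n = z * G' (n - 1)\<close>, the
  derivative being taken in \<open>z\<close>.
  Starting from the reflection formula of the digamma function, this identifies \<open>G n\<close> with a multiple
  of the sum of \<open>(x + k) powi (- n - 1)\<close> over all integers \<open>k\<close>. Hence, up to one common positive factor
  and powers of \<open>2 * pi\<close>, the symbols \<open>m\<close>, \<open>- a\<close>, \<open>s\<close> are these sums with exponents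
  \<open>2 * p + 2\<close>, \<open>2 * p + 1\<close>, \<open>2 * p\<close>, and the inequality is Cauchy--Schwarz; \<open>\<theta> = 0\<close> follows by
  continuity. The matrices \<open>f - min \<alpha> \<beta> * L\<close> and \<open>max \<alpha> \<beta> * L - f\<close> then have nonnegative trace and
  determinant.
\<close>

subsection \<open>Derivatives and symmetry of B-splines\<close>

text \<open>The value at 0 is \<open>0 ^ n\<close>, so \<open>trunc_pow 0 0 = 1\<close>; this
  matches the half-open interval of \<open>bspline 0\<close>.\<close>

definition trunc_pow :: "nat \<Rightarrow> real \<Rightarrow> real" where
  "trunc_pow n t = (if t \<ge> 0 then t ^ n else 0)"

lemma trunc_pow_Suc: "trunc_pow (Suc n) t = t * trunc_pow n t"
  by (simp add: trunc_pow_def)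

text \<open>An exponent of at least 2 makes both one-sided derivatives vanish at 0, so the two
  branches glue to a differentiable function.\<close>

lemma has_real_derivative_trunc_pow:
  "(trunc_pow (Suc (Suc n)) has_real_derivative real (Suc (Suc n)) * trunc_pow (Suc n) t) (at t)"
proof -
  have pow: "((\<lambda>t. t ^ Suc (Suc n)) has_derivative (\<lambda>h. h * (real (Suc (Suc n)) * t ^ Suc n)))
      (at t within A)" for A
    using DERIV_pow[of "Suc (Suc n)" t A]
    by (simp add: has_field_derivative_def mult_commute_abs del: power_Suc of_nat_Suc)
  have "((\<lambda>t. if t \<in> {0..} then t ^ Suc (Suc n) else 0) has_derivative
      (if t \<in> {0..} then (\<lambda>h. h * (real (Suc (Suc n)) * t ^ Suc n)) else (\<lambda>h. h * 0))) (at t within {0..} \<union> {..<0})"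
  proof (rule has_derivative_If_within_closures[where T = "{..<0}" and S = "{0..}" and x = t
        and f' = "\<lambda>t h. h * (real (Suc (Suc n)) * t ^ Suc n)" and g' = "\<lambda>t h. h * 0"])
    show "((\<lambda>t. t ^ Suc (Suc n)) has_derivative (\<lambda>h. h * (real (Suc (Suc n)) * t ^ Suc n)))
      (at t within {0..} \<union> closure {0..} \<inter> closure {..<0})"
      by (rule pow)
  qed auto
  moreover have "{0..} \<union> {..<0::real} = UNIV"
    by auto
  ultimately show ?thesis
    unfolding has_field_derivative_def trunc_pow_def
    by (auto elim!: has_derivative_eq_rhs simp: fun_eq_iff)
qed

text \<open>This classical form, a backward difference of a truncated power, can be differentiated
  term by term. The induction compares the coefficients of the shifted powers.\<close>

lemma bspline_eq_trunc_pow: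
  "bspline n t = (\<Sum>j\<le>Suc n. (-1) ^ j * real (Suc n choose j) * trunc_pow n (t - real j)) / fact n"
proof (induction n arbitrary: t)
  case 0
  show ?case by (auto simp: trunc_pow_def)
next
  case (Suc n)
  define T where "T j = trunc_pow n (t - real j)" for j
  have 1: "bspline n t = (\<Sum>j\<le>Suc (Suc n). (-1) ^ j * real (Suc n choose j) * T j) / fact n"
    by (subst Suc) (simp add: T_def binomial_eq_0 del: binomial_Suc_Suc)
  have shift: "bspline n (t - 1) = (\<Sum>j\<le>Suc n. (-1) ^ j * real (Suc n choose j) * T (Suc j)) / fact n"
    by (simp add: Suc T_def algebra_simps)
  \<comment> \<open>The \<open>if\<close> supplies the coefficient 0 at j = 0, where truncated
    subtraction would give \<open>Suc n choose 0\<close>.\<close>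
  have "(\<Sum>j\<le>Suc n. (-1) ^ j * real (Suc n choose j) * T (Suc j))
      = - (\<Sum>j\<le>Suc (Suc n). (-1) ^ j * real (if j = 0 then 0 else Suc n choose (j - 1)) * T j)"
    by (subst (2) sum.atMost_Suc_shift) (simp add: sum_negf[symmetric])
  then have 2: "bspline n (t - 1)
      = - (\<Sum>j\<le>Suc (Suc n). (-1) ^ j * real (if j = 0 then 0 else Suc n choose (j - 1)) * T j) / fact n"
    using shift by simp
  \<comment> \<open>The absorption identity and Pascal's rule merge the two coefficients and release
    the factor t - j that raises the power.\<close>
  have *: "t * real (Suc n choose j) - (real (Suc n) + 1 - t) * real (if j = 0 then 0 else Suc n choose (j - 1))
      = real (Suc (Suc n) choose j) * (t - real j)" for j
  proof (cases j)
    case (Suc i)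
    have "real (Suc (Suc n)) * real (Suc n choose i) = real (Suc i) * real (Suc (Suc n) choose Suc i)"
      using Suc_times_binomial_eq[of "Suc n" i] by (metis of_nat_mult mult.commute)
    moreover have "real (Suc (Suc n) choose Suc i) = real (Suc n choose Suc i) + real (Suc n choose i)"
      by simp
    ultimately show ?thesis
      unfolding Suc by (simp add: algebra_simps del: binomial_Suc_Suc)
  qed simp
  have "t * bspline n t + (real (Suc n) + 1 - t) * bspline n (t - 1)
      = (\<Sum>j\<le>Suc (Suc n). (-1) ^ j * T j * (t * real (Suc n choose j)
        - (real (Suc n) + 1 - t) * real (if j = 0 then 0 else Suc n choose (j - 1)))) / fact n"
    unfolding 1 2 times_divide_eq_right add_divide_distrib[symmetric] mult_minus_right
    by (simp only: sum_distrib_left diff_conv_add_uminus[symmetric] sum_subtractf[symmetric])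
       (simp only: algebra_simps)
  also have "\<dots> = (\<Sum>j\<le>Suc (Suc n). (-1) ^ j * real (Suc (Suc n) choose j)
      * trunc_pow (Suc n) (t - real j)) / fact n"
    unfolding * trunc_pow_Suc T_def by (simp only: mult_ac)
  finally have "(t * bspline n t + (real (Suc n) + 1 - t) * bspline n (t - 1)) / real (Suc n)
      = (\<Sum>j\<le>Suc (Suc n). (-1) ^ j * real (Suc (Suc n) choose j)
      * trunc_pow (Suc n) (t - real j)) / (fact n * real (Suc n))"
    by (simp only: divide_divide_eq_left)
  then show ?case
    by (simp only: bspline.simps fact_Suc mult.commute add_divide_distrib
        times_divide_eq_left times_divide_eq_right)
qed

text \<open>Differentiation lowers the truncated powers by one degree; Pascal's rule splits the
  coefficients into those of a spline and of its translate. The knots are included, since the degree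
  is at least 2.\<close>

lemma has_real_derivative_bspline:
  "(bspline (Suc (Suc n)) has_real_derivative bspline (Suc n) t - bspline (Suc n) (t - 1)) (at t)"
proof -
  define c where "c m j = (-1) ^ j * real (m choose j)" for m j
  define T where "T j = trunc_pow (Suc n) (t - real j)" for j
  define N where "N = Suc (Suc n)"
  have "((\<lambda>t. (\<Sum>j\<le>Suc N. c (Suc N) j * trunc_pow N (t - real j)) / fact N)
      has_real_derivative (\<Sum>j\<le>Suc N. c (Suc N) j * (real N * T j * 1)) / fact N) (at t)"
    unfolding N_def T_def
    by (intro DERIV_cdivide DERIV_sum DERIV_cmult DERIV_chain2[OF has_real_derivative_trunc_pow])
       (auto intro!: derivative_eq_intros)
  moreover have "bspline N = (\<lambda>t. (\<Sum>j\<le>Suc N. c (Suc N) j * trunc_pow N (t - real j)) / fact N)"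
    by (simp add: fun_eq_iff bspline_eq_trunc_pow c_def)
  moreover have "(\<Sum>j\<le>Suc N. c (Suc N) j * (real N * T j * 1)) / fact N
      = (\<Sum>j\<le>Suc N. c (Suc N) j * T j) / fact (Suc n)"
    unfolding N_def fact_Suc[of "Suc n"] 
    by (simp only: mult_1_right mult.left_commute[of "c _ _"] sum_distrib_left[symmetric] of_nat_mult)
       (simp only: mult_divide_mult_cancel_left_if of_nat_eq_0_iff of_nat_fact, simp)
  moreover have "(\<Sum>j\<le>Suc N. c (Suc N) j * T j)
      = (\<Sum>j\<le>N. c N j * T j) - (\<Sum>j\<le>N. c N j * T (Suc j))"
  proof -
    have "(\<Sum>j\<le>Suc N. c (Suc N) j * T j) = T 0 + (\<Sum>j\<le>N. c (Suc N) (Suc j) * T (Suc j))"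
      by (subst sum.atMost_Suc_shift) (simp add: c_def)
    also have "\<dots> = T 0 + (\<Sum>j\<le>N. c N (Suc j) * T (Suc j)) - (\<Sum>j\<le>N. c N j * T (Suc j))"
      by (simp add: c_def algebra_simps sum.distrib sum_subtractf sum_negf)
    also have "T 0 + (\<Sum>j\<le>N. c N (Suc j) * T (Suc j)) = (\<Sum>j\<le>Suc N. c N j * T j)"
      by (simp only: sum.atMost_Suc_shift) (simp add: c_def)
    also have "\<dots> = (\<Sum>j\<le>N. c N j * T j)"
      by (simp add: c_def)
    finally show ?thesis .
  qed
  moreover have "bspline (Suc n) t = (\<Sum>j\<le>N. c N j * T j) / fact (Suc n)"
    "bspline (Suc n) (t - 1) = (\<Sum>j\<le>N. c N j * T (Suc j)) / fact (Suc n)"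
    unfolding bspline_eq_trunc_pow N_def c_def T_def by (simp_all only: of_nat_Suc diff_diff_eq)
  ultimately show ?thesis
    unfolding N_def by (simp only: diff_divide_distrib)
qed

lemma deriv_bspline:
  assumes "n \<ge> 2"
  shows "deriv (bspline n) = (\<lambda>t. bspline (n - 1) t - bspline (n - 1) (t - 1))"
proof
  obtain m where "n = Suc (Suc m)"
    using assms that[of "n - 2"] by simp
  then show "deriv (bspline n) t = bspline (n - 1) t - bspline (n - 1) (t - 1)" for t
    using has_real_derivative_bspline[of m t] by (auto intro: DERIV_imp_deriv simp del: bspline.simps)
qed

lemma deriv_deriv_bspline:
  assumes "n \<ge> 3"
  shows "deriv (deriv (bspline n)) t =
    bspline (n - 2) t - 2 * bspline (n - 2) (t - 1) + bspline (n - 2) (t - 2)"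
proof -
  obtain m where m: "n = Suc (Suc (Suc m))"
    using assms that[of "n - 3"] by simp
  have "((\<lambda>t. bspline (Suc (Suc m)) t - bspline (Suc (Suc m)) (t - 1)) has_real_derivative
     (bspline (Suc m) t - bspline (Suc m) (t - 1)) - (bspline (Suc m) (t - 1) - bspline (Suc m) (t - 1 - 1)) * 1) (at t)"
    by (rule DERIV_diff DERIV_chain2 has_real_derivative_bspline)+ (auto intro!: derivative_eq_intros)
  then show ?thesis
    by (simp add: m deriv_bspline DERIV_imp_deriv del: bspline.simps)
qed

section \<open>Support and symmetry\<close>

lemma bspline_neg: "t < 0 \<Longrightarrow> bspline n t = 0"
  by (induction n arbitrary: t) auto

lemma bspline_ge: "t \<ge> real n + 1 \<Longrightarrow> bspline n t = 0"
  by (induction n arbitrary: t) auto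

lemma bspline_0: "n > 0 \<Longrightarrow> bspline n 0 = 0"
  by (cases n) (auto simp: bspline_neg)

text \<open>Reflection swaps the two terms of the recurrence. The induction starts at 1 because the
  half-open indicator \<open>bspline 0\<close> is not symmetric at the end points.\<close>

lemma bspline_symmetric:
  assumes "n > 0"
  shows "bspline n (real n + 1 - t) = bspline n t"
  using assms
proof (induction n arbitrary: t rule: nat_induct_non_zero)
  case 1
  show ?case by auto
next
  case (Suc n)
  show ?case
    using Suc.IH[of t] Suc.IH[of "t - 1"] by (simp add: algebra_simps)
qed

subsection \<open>The digamma reflection formula\<close>

text \<open>This is the logarithmic derivative of Euler's reflection formula, taken for the entire
  function \<open>rGamma\<close> to avoid poles.\<close>

lemma Digamma_reflection:
  fixes z :: complex
  assumes "z \<notin> \<int>"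
  shows "Digamma (1 - z) - Digamma z = of_real pi * cos (of_real pi * z) / sin (of_real pi * z)"
proof -
  have z: "z \<notin> \<int>\<^sub>\<le>\<^sub>0" "1 - z \<notin> \<int>\<^sub>\<le>\<^sub>0"
    using assms nonpos_Ints_subset_Ints Ints_diff[OF Ints_1, of "1 - z"] by auto
  have "((\<lambda>z. rGamma z * rGamma (1 - z)) has_field_derivative
      (rGamma z * rGamma (1 - z)) * (Digamma (1 - z) - Digamma z)) (at z)"
    using z by (auto intro!: derivative_eq_intros simp: algebra_simps)
  moreover have "((\<lambda>z. sin (of_real pi * z) / of_real pi) has_field_derivative
      cos (of_real pi * z)) (at z)"
    by (auto intro!: derivative_eq_intros)
  ultimately have "sin (of_real pi * z) / of_real pi * (Digamma (1 - z) - Digamma z) = cos (of_real pi * z)"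
    unfolding rGamma_reflection_complex by (rule DERIV_unique)
  moreover have "sin (of_real pi * z) \<noteq> 0"
    using assms by (auto simp: sin_eq_0 mult.commute)
  ultimately show ?thesis
    by (simp add: field_simps)
qed

subsection \<open>Exponential splines and lattice sums\<close>

text \<open>For n > 0 this is z times the Eulerian polynomial of degree n - 1, divided by
  \<open>fact n\<close>.\<close>

definition exp_spline :: "nat \<Rightarrow> complex \<Rightarrow> complex" where
  "exp_spline n z = (\<Sum>k\<le>n. of_real (bspline n (real k)) * z ^ k)"

text \<open>For |z| < 1 this is the sum of k ^ n * z ^ k / n! over k >= 0; the rational form also
  makes sense on the unit circle away from 1.\<close>

definition euler_quot :: "nat \<Rightarrow> complex \<Rightarrow> complex" where
  "euler_quot n z = exp_spline n z / (1 - z) ^ Suc n"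

text \<open>Multiply the recurrence at the integers by z ^ k, sum, and shift the index. The sum on
  the right is z times the derivative of \<open>exp_spline n\<close>.\<close>

lemma exp_spline_Suc:
  "of_nat (Suc n) * exp_spline (Suc n) z =
     (1 - z) * (\<Sum>k\<le>n. of_nat k * of_real (bspline n (real k)) * z ^ k) + of_nat (Suc n) * z * exp_spline n z"
proof -
  \<comment> \<open>Boundary terms that drop when both sums are brought to the range k <= n.\<close>
  have z: "bspline n (1 + real n) = 0" "bspline n (-1) = 0"
    by (simp_all add: bspline_neg bspline_ge)
  have "of_nat (Suc n) * exp_spline (Suc n) z = (\<Sum>k\<le>Suc n. of_nat k * of_real (bspline n (real k)) * z ^ k)
    + (\<Sum>k\<le>Suc n. (of_nat (Suc n) + 1 - of_nat k) * of_real (bspline n (real k - 1)) * z ^ k)"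
    unfolding exp_spline_def sum_distrib_left sum.distrib[symmetric]
  proof (intro sum.cong refl)
    fix k
    have "of_nat (Suc n) * complex_of_real (bspline (Suc n) (real k))
        = of_real (real (Suc n) * bspline (Suc n) (real k))"
      by simp
    also have "real (Suc n) * bspline (Suc n) (real k)
        = real k * bspline n (real k) + (real (Suc n) + 1 - real k) * bspline n (real k - 1)"
      by (simp add: distrib_left del: of_nat_Suc)
    finally show "of_nat (Suc n) * (complex_of_real (bspline (Suc n) (real k)) * z ^ k)
        = of_nat k * of_real (bspline n (real k)) * z ^ k
          + (of_nat (Suc n) + 1 - of_nat k) * of_real (bspline n (real k - 1)) * z ^ k"
      unfolding mult.assoc[symmetric] by (simp add: distrib_right del: bspline.simps of_nat_Suc)
  qed
  also have "(\<Sum>k\<le>Suc n. of_nat k * of_real (bspline n (real k)) * z ^ k)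
     = (\<Sum>k\<le>n. of_nat k * of_real (bspline n (real k)) * z ^ k)"
    by (simp add: z)
  also have "(\<Sum>k\<le>Suc n. (of_nat (Suc n) + 1 - of_nat k) * of_real (bspline n (real k - 1)) * z ^ k)
     = (\<Sum>k\<le>n. (of_nat (Suc n) - of_nat k) * of_real (bspline n (real k)) * z ^ Suc k)"
    by (subst sum.atMost_Suc_shift) (simp add: z add_diff_eq)
  also have "\<dots> = of_nat (Suc n) * z * exp_spline n z - z * (\<Sum>k\<le>n. of_nat k * of_real (bspline n (real k)) * z ^ k)"
    unfolding exp_spline_def sum_distrib_left sum_subtractf[symmetric]
    by (intro sum.cong refl) (simp add: algebra_simps)
  finally show ?thesis by (simp add: algebra_simps)
qed

text \<open>
  Differentiation in \<open>u\<close> turns the three-term recurrence of the splines into a shift of \<open>n\<close>,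
  exactly as it does for the polygamma functions.
\<close>

lemma has_field_derivative_euler_quot:
  assumes "exp (c * u) \<noteq> 1"
  shows "((\<lambda>u. euler_quot n (exp (c * u))) has_field_derivative
     c * of_nat (Suc n) * euler_quot (Suc n) (exp (c * u))) (at u)"
proof -
  define z where "z = exp (c * u)"
  define D where "D = (\<Sum>k\<le>n. of_nat k * of_real (bspline n (real k)) * z ^ k)"
  have z: "1 - z \<noteq> 0"
    using assms by (simp add: z_def)
  have 1: "((\<lambda>u. exp_spline n (exp (c * u))) has_field_derivative c * D) (at u)"
    unfolding exp_spline_def D_def sum_distrib_left z_def
    by (rule DERIV_sum)
      (auto intro!: derivative_eq_intros simp: exp_of_nat_mult[symmetric] exp_add[symmetric] algebra_simps)
  have 2: "((\<lambda>u. (1 - exp (c * u)) ^ Suc n) has_field_derivative - c * of_nat (Suc n) * z * (1 - z) ^ n) (at u)"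
    unfolding z_def
    by (rule DERIV_power[THEN DERIV_cong], auto intro!: derivative_eq_intros)
  have "((\<lambda>u. euler_quot n (exp (c * u))) has_field_derivative
      ((c * D) * (1 - z) ^ Suc n - exp_spline n z * (- c * of_nat (Suc n) * z * (1 - z) ^ n)) /
      ((1 - z) ^ Suc n * (1 - z) ^ Suc n)) (at u)"
    unfolding euler_quot_def
    using DERIV_divide[OF 1 2] z by (simp add: z_def del: power_Suc of_nat_Suc)
  also have "((c * D) * (1 - z) ^ Suc n - exp_spline n z * (- c * of_nat (Suc n) * z * (1 - z) ^ n))
    = c * (1 - z) ^ n * ((1 - z) * D + of_nat (Suc n) * z * exp_spline n z)"
    by (simp add: algebra_simps)
  \<comment> \<open>The numerator of the quotient rule contains exactly the right side of
    \<open>exp_spline_Suc\<close>.\<close>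
  also have "(1 - z) * D + of_nat (Suc n) * z * exp_spline n z = of_nat (Suc n) * exp_spline (Suc n) z"
    unfolding exp_spline_Suc D_def ..
  also have "c * (1 - z) ^ n * (of_nat (Suc n) * exp_spline (Suc n) z) / ((1 - z) ^ Suc n * (1 - z) ^ Suc n)
    = c * of_nat (Suc n) * euler_quot (Suc n) z"
    using z by (simp add: euler_quot_def del: of_nat_Suc)
  finally show ?thesis
    by (simp add: z_def)
qed


lemma not_Ints_of_Re:
  assumes "0 < Re u" "Re u < 1"
  shows "u \<notin> \<int>"
  using assms by (auto elim!: Ints_cases)

text \<open>The base case is the reflection formula, as 1 / (1 - z) = 1/2 + (i/2) cot (pi u).
  Differentiation in u raises n by one on both sides and removes the constant pi, which stems from
  the 1/2.\<close>

lemma euler_quot_eq_Polygamma: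
  assumes "0 < Re u" "Re u < 1"
  shows "fact n * (2 * of_real pi) ^ Suc n * euler_quot n (exp (2 * of_real pi * \<i> * u))
    = (if n = 0 then of_real pi else 0)
      + \<i> ^ Suc n * ((-1) ^ Suc n * Polygamma n u + Polygamma n (1 - u))"
  using assms
proof (induction n arbitrary: u)
  case 0
  \<comment> \<open>With the half-angle exponential w, both z and the cotangent are rational in
    w.\<close>
  define w where "w = exp (\<i> * (of_real pi * u))"
  have u: "u \<notin> \<int>"
    using 0 by (rule not_Ints_of_Re)
  then have "sin (of_real pi * u) \<noteq> 0"
    by (auto simp: sin_eq_0 mult.commute)
  have z: "exp (2 * of_real pi * \<i> * u) = w * w"
    by (simp add: w_def exp_add[symmetric] algebra_simps)
  have w: "w \<noteq> 0" "exp (- (\<i> * (of_real pi * u))) = 1 / w"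
    by (auto simp: w_def exp_minus divide_inverse)
  have s: "sin (of_real pi * u) = (w - 1 / w) / (2 * \<i>)" "cos (of_real pi * u) = (w + 1 / w) / 2"
    by (simp_all add: sin_exp_eq cos_exp_eq w w_def[symmetric])
  have "w * w \<noteq> 1"
  proof
    assume "w * w = 1"
    then have "1 / w = w"
      using w(1) by (simp add: field_simps)
    then show False
      using \<open>sin _ \<noteq> 0\<close> by (simp add: s)
  qed
  have "exp_spline 0 (w * w) = 1"
    by (simp add: exp_spline_def)
  then show ?case
    using w(1) \<open>w * w \<noteq> 1\<close> Digamma_reflection[OF u, unfolded s]
    by (simp add: z euler_quot_def divide_simps) (simp add: algebra_simps)
next
  case (Suc n)
  define c where "c = 2 * of_real pi * \<i>"
  define S where "S = {u. 0 < Re u \<and> Re u < 1}"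
  have "open S"
    unfolding S_def by (intro open_Collect_conj open_halfspace_Re_gt open_halfspace_Re_lt)
  have u: "u \<notin> \<int>" "1 - u \<notin> \<int>"
    using Suc.prems not_Ints_of_Re[of u] not_Ints_of_Re[of "1 - u"] by auto
  have "exp (c * u) \<noteq> 1"
    using Suc.prems by (auto simp: c_def exp_eq_1)
  have "((\<lambda>u. fact n * (2 * of_real pi) ^ Suc n * euler_quot n (exp (c * u))) has_field_derivative
      fact n * (2 * of_real pi) ^ Suc n * (c * of_nat (Suc n) * euler_quot (Suc n) (exp (c * u)))) (at u)"
    by (intro DERIV_cmult has_field_derivative_euler_quot) fact
  moreover have "((\<lambda>u. fact n * (2 * of_real pi) ^ Suc n * euler_quot n (exp (c * u))) has_field_derivative
      \<i> ^ Suc n * ((-1) ^ Suc n * Polygamma (Suc n) u - Polygamma (Suc n) (1 - u))) (at u)"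
  proof (rule has_field_derivative_transform_within_open)
    show "((\<lambda>u. (if n = 0 then of_real pi else 0)
        + \<i> ^ Suc n * ((-1) ^ Suc n * Polygamma n u + Polygamma n (1 - u))) has_field_derivative
        \<i> ^ Suc n * ((-1) ^ Suc n * Polygamma (Suc n) u - Polygamma (Suc n) (1 - u))) (at u)"
      using u nonpos_Ints_subset_Ints
      by (auto intro!: derivative_eq_intros simp del: power_Suc)
    show "open S" by fact
    show "u \<in> S" using Suc.prems by (simp add: S_def)
  qed (simp only: Suc.IH S_def c_def mem_Collect_eq)
  ultimately have *: "fact n * (2 * of_real pi) ^ Suc n * (c * of_nat (Suc n) * euler_quot (Suc n) (exp (c * u)))
    = \<i> ^ Suc n * ((-1) ^ Suc n * Polygamma (Suc n) u - Polygamma (Suc n) (1 - u))"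
    by (rule DERIV_unique)
  \<comment> \<open>The factor i completes 2 * pi to the constant c; it is cancelled at the
    end.\<close>
  have "\<i> * (fact (Suc n) * (2 * of_real pi) ^ Suc (Suc n) * euler_quot (Suc n) (exp (c * u)))
     = fact n * (2 * of_real pi) ^ Suc n * (c * of_nat (Suc n) * euler_quot (Suc n) (exp (c * u)))"
    by (simp add: c_def)
  also note *
  also have "\<i> ^ Suc n * ((-1) ^ Suc n * Polygamma (Suc n) u - Polygamma (Suc n) (1 - u))
     = \<i> * (\<i> ^ Suc (Suc n) * ((-1) ^ Suc (Suc n) * Polygamma (Suc n) u + Polygamma (Suc n) (1 - u)))"
    by (simp add: algebra_simps)
  finally show ?case
    unfolding c_def by (subst (asm) mult_cancel_left) simp
qed

text \<open>
  For \<open>n \<ge> 2\<close> this is the sum of \<open>(x + k) powi (-n)\<close> over all integers \<open>k\<close>, the negative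
  \<open>k\<close> being collected in the term with \<open>1 - x\<close>.
\<close>

definition lattice_sum :: "nat \<Rightarrow> real \<Rightarrow> real" where
  "lattice_sum n x = ((-1) ^ n * Polygamma (n - 1) x + Polygamma (n - 1) (1 - x)) / fact (n - 1)"

text \<open>The k-th term pairs the integers k and -k - 1, as x - (k + 1) = -(1 - x + k). Each half
  is a Polygamma series, convergent since n >= 2.\<close>

lemma sums_lattice_sum:
  assumes "n \<ge> 2" "0 < x" "x < 1"
  shows "(\<lambda>k. (1 / (x + real k)) ^ n + (-1 / (1 - x + real k)) ^ n) sums lattice_sum n x"
proof -
  obtain m where m: "n = Suc m" "m > 0"
    using assms that[of "n - 1"] by simp
  have "(\<lambda>k. inverse ((x + of_nat k) ^ Suc m) + (-1) ^ n * inverse ((1 - x + of_nat k) ^ Suc m)) sums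
     ((-1) ^ Suc m * Polygamma m x / fact m + (-1) ^ n * ((-1) ^ Suc m * Polygamma m (1 - x) / fact m))"
    by (intro sums_add sums_mult Polygamma_LIMSEQ) (use assms m in auto)
  also have "(-1) ^ Suc m * Polygamma m x / fact m + (-1) ^ n * ((-1) ^ Suc m * Polygamma m (1 - x) / fact m) = lattice_sum n x"
    by (simp add: lattice_sum_def m diff_divide_distrib)
  finally show ?thesis
    unfolding m(1)[symmetric] by (simp only: of_nat_id power_mult_distrib power_inverse divide_inverse mult_1)
qed

section \<open>Positivity and Cauchy-Schwarz for lattice sums\<close>

lemma lattice_sum_even_nonneg:
  assumes "0 < x" "x < 1" "even n" "n \<ge> 2"
  shows "lattice_sum n x \<ge> 0"
proof (rule sums_le)
  show "(\<lambda>k. (1 / (x + real k)) ^ n + (-1 / (1 - x + real k)) ^ n) sums lattice_sum n x"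
    using assms by (intro sums_lattice_sum)
  show "0 \<le> (1 / (x + real k)) ^ n + (-1 / (1 - x + real k)) ^ n" for k
    by (intro add_nonneg_nonneg zero_le_even_power \<open>even n\<close>)
qed simp

text \<open>Evaluate at the vertex t = -b/a; if a = 0, an affine function bounded below has slope
  0.\<close>

lemma discriminant_le:
  fixes a b c :: real
  assumes "\<And>t. t\<^sup>2 * a + 2 * t * b + c \<ge> 0" and "a \<ge> 0"
  shows "b\<^sup>2 \<le> a * c"
proof (cases "a = 0")
  case True
  have "b = 0"
  proof (rule ccontr)
    assume "b \<noteq> 0"
    \<comment> \<open>This t gives the affine function the value -1.\<close>
    then show False
      using assms(1)[of "- (c + 1) / (2 * b)"] True by (simp add: field_simps)
  qed
  then show ?thesis
    using True by simp
next
  case False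
  have "(- b / a)\<^sup>2 * a + 2 * (- b / a) * b + c = (a * c - b\<^sup>2) / a"
    using False by (simp add: field_simps power2_eq_square)
  then show ?thesis
    using assms(1)[of "- b / a"] assms(2) False by (simp add: zero_le_divide_iff)
qed

text \<open>The quadratic in t is a series of squares of t * y ^ (p + 1) + y ^ p, with y the
  reciprocals of the lattice points, so its discriminant is not positive. All three series converge
  since 2 * p >= 2.\<close>

lemma lattice_sum_Cauchy_Schwarz:
  assumes "0 < x" "x < 1" "p \<ge> 1"
  shows "(lattice_sum (2 * p + 1) x)\<^sup>2 \<le> lattice_sum (2 * p + 2) x * lattice_sum (2 * p) x"
proof (rule discriminant_le)
  show "lattice_sum (2 * p + 2) x \<ge> 0"
    using assms by (intro lattice_sum_even_nonneg) auto
next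
  fix t :: real
  define f where "f y = (t * y ^ (p + 1) + y ^ p)\<^sup>2" for y :: real
  have f: "t\<^sup>2 * y ^ (2 * p + 2) + 2 * t * y ^ (2 * p + 1) + y ^ (2 * p) = f y" for y
  proof -
    have "y ^ (2 * p + 2) = (y ^ (p + 1))\<^sup>2" "y ^ (2 * p + 1) = y ^ (p + 1) * y ^ p" "y ^ (2 * p) = (y ^ p)\<^sup>2"
      by (simp_all only: power2_eq_square power_add[symmetric], simp_all add: mult_2)
    then show ?thesis
      unfolding f_def by (simp only:) (simp add: power2_sum power_mult_distrib del: power_Suc)
  qed
  show "t\<^sup>2 * lattice_sum (2 * p + 2) x + 2 * t * lattice_sum (2 * p + 1) x + lattice_sum (2 * p) x \<ge> 0"
  proof (rule sums_le)
    show "(\<lambda>_. 0::real) sums 0" by simp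
    show "(\<lambda>k. t\<^sup>2 * ((1 / (x + real k)) ^ (2 * p + 2) + (-1 / (1 - x + real k)) ^ (2 * p + 2))
      + 2 * t * ((1 / (x + real k)) ^ (2 * p + 1) + (-1 / (1 - x + real k)) ^ (2 * p + 1))
      + ((1 / (x + real k)) ^ (2 * p) + (-1 / (1 - x + real k)) ^ (2 * p)))
      sums (t\<^sup>2 * lattice_sum (2 * p + 2) x + 2 * t * lattice_sum (2 * p + 1) x + lattice_sum (2 * p) x)"
      by (intro sums_add sums_mult sums_lattice_sum) (use assms in auto)
    show "0 \<le> t\<^sup>2 * ((1 / (x + real k)) ^ (2 * p + 2) + (-1 / (1 - x + real k)) ^ (2 * p + 2))
      + 2 * t * ((1 / (x + real k)) ^ (2 * p + 1) + (-1 / (1 - x + real k)) ^ (2 * p + 1))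
      + ((1 / (x + real k)) ^ (2 * p) + (-1 / (1 - x + real k)) ^ (2 * p))" for k
    proof -
      have "0 \<le> f (1 / (x + real k)) + f (-1 / (1 - x + real k))"
        by (simp add: f_def)
      also have "\<dots> = t\<^sup>2 * ((1 / (x + real k)) ^ (2 * p + 2) + (-1 / (1 - x + real k)) ^ (2 * p + 2))
      + 2 * t * ((1 / (x + real k)) ^ (2 * p + 1) + (-1 / (1 - x + real k)) ^ (2 * p + 1))
      + ((1 / (x + real k)) ^ (2 * p) + (-1 / (1 - x + real k)) ^ (2 * p))"
        unfolding f[symmetric] by (simp only: algebra_simps)
      finally show ?thesis .
    qed
  qed
qed

text \<open>At real arguments the Polygamma values are real, so the whole phase sits in the power of
  i. For n > 0 the constant pi is absent.\<close>

lemma euler_quot_eq_lattice_sum: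
  assumes "0 < x" "x < 1" "n > 0"
  shows "euler_quot n (cis (2 * pi * x)) = (\<i> / (2 * of_real pi)) ^ Suc n * of_real (lattice_sum (Suc n) x)"
proof -
  have "Polygamma n (1 - of_real x) = complex_of_real (Polygamma n (1 - x))"
    using Polygamma_of_real[of "1 - x" n, where 'a = complex] assms by simp
  moreover have "Polygamma n (of_real x) = complex_of_real (Polygamma n x)"
    using Polygamma_of_real[of x n, where 'a = complex] assms by simp
  moreover have "exp (2 * of_real pi * \<i> * of_real x) = cis (2 * pi * x)"
    by (simp add: cis_conv_exp mult_ac)
  ultimately have "fact n * (2 * of_real pi) ^ Suc n * euler_quot n (cis (2 * pi * x))
    = \<i> ^ Suc n * of_real (fact n * lattice_sum (Suc n) x)"
    using euler_quot_eq_Polygamma[of "of_real x" n] assms by (simp add: lattice_sum_def)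
  then have "fact n * ((2 * of_real pi) ^ Suc n * euler_quot n (cis (2 * pi * x)))
    = fact n * (\<i> ^ Suc n * complex_of_real (lattice_sum (Suc n) x))"
    by (simp only: of_real_mult of_real_fact mult_ac)
  then have "(2 * of_real pi) ^ Suc n * euler_quot n (cis (2 * pi * x))
    = \<i> ^ Suc n * complex_of_real (lattice_sum (Suc n) x)"
    by (simp only: mult_cancel_left fact_nonzero simp_thms)
  then have "euler_quot n (cis (2 * pi * x))
    = \<i> ^ Suc n * complex_of_real (lattice_sum (Suc n) x) / (2 * of_real pi) ^ Suc n"
    by (subst nonzero_eq_divide_eq) (simp, simp only: mult.commute)
  then show ?thesis
    by (simp only: power_divide times_divide_eq_left)
qed

subsection \<open>The univariate symbols\<close>

text \<open>The bound p <= q keeps q - l free of truncation.\<close>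

lemma sum_symmetric_interval:
  fixes f :: "nat \<Rightarrow> 'a :: comm_monoid_add"
  assumes "p \<le> q"
  shows "(\<Sum>k = q - p..q + p. f k) = f q + (\<Sum>l = 1..p. f (q - l) + f (q + l))"
  using assms
proof (induction p)
  case (Suc p)
  have "{q - Suc p..q + Suc p} = insert (q - Suc p) (insert (q + Suc p) {q - p..q + p})"
    using Suc.prems by auto
  moreover have "q - Suc p \<notin> insert (q + Suc p) {q - p..q + p}" "q + Suc p \<notin> {q - p..q + p}"
    using Suc.prems by auto
  ultimately have "(\<Sum>k = q - Suc p..q + Suc p. f k) = f (q - Suc p) + (f (q + Suc p) + (\<Sum>k = q - p..q + p. f k))"
    by (simp only: sum.insert finite_insert finite_atLeastAtMost not_False_eq_True)
  then show ?case
    using Suc by (simp add: add_ac)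
qed simp

text \<open>The powers p + 1 - l and p + 1 + l carry equal coefficients; once the middle power is
  factored out, each pair gives a factor 2 cos (l \<theta>).\<close>

lemma sum_cis_even:
  assumes "\<And>l. l \<in> {1..p} \<Longrightarrow> g (Suc p + l) = g (Suc p - l)"
  shows "(\<Sum>k = 1..2 * p + 1. of_real (g k) * cis \<theta> ^ k)
    = cis \<theta> ^ Suc p * of_real (g (Suc p) + 2 * (\<Sum>l = 1..p. g (Suc p - l) * cos (real l * \<theta>)))"
proof -
  have "of_real (g (Suc p - l)) * cis \<theta> ^ (Suc p - l) + of_real (g (Suc p + l)) * cis \<theta> ^ (Suc p + l)
      = cis \<theta> ^ Suc p * of_real (2 * (g (Suc p - l) * cos (real l * \<theta>)))" if "l \<in> {1..p}" for l
  proof -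
    have "cis \<theta> ^ (Suc p - l) + cis \<theta> ^ (Suc p + l) = cis \<theta> ^ Suc p * (cis (- (real l * \<theta>)) + cis (real l * \<theta>))"
      using that by (simp add: Complex.DeMoivre cis_mult algebra_simps del: power_Suc)
    also have "cis (- (real l * \<theta>)) + cis (real l * \<theta>) = of_real (2 * cos (real l * \<theta>))"
      by (simp add: complex_eq_iff)
    finally show ?thesis
      using assms[OF that] by (simp add: distrib_left[symmetric] del: power_Suc)
  qed
  note * = this
  have "{1..2 * p + 1} = {Suc p - p..Suc p + p}"
    by auto
  then have "(\<Sum>k = 1..2 * p + 1. of_real (g k) * cis \<theta> ^ k) = of_real (g (Suc p)) * cis \<theta> ^ Suc p
      + (\<Sum>l = 1..p. of_real (g (Suc p - l)) * cis \<theta> ^ (Suc p - l) + of_real (g (Suc p + l)) * cis \<theta> ^ (Suc p + l))"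
    using sum_symmetric_interval[of p "Suc p" "\<lambda>k. of_real (g k) * cis \<theta> ^ k"] by (simp only: le_SucI order_refl)
  also have "\<dots> = of_real (g (Suc p)) * cis \<theta> ^ Suc p
      + (\<Sum>l = 1..p. cis \<theta> ^ Suc p * of_real (2 * (g (Suc p - l) * cos (real l * \<theta>))))"
    by (intro arg_cong2[of _ _ _ _ "(+)"] sum.cong refl *)
  also have "\<dots> = cis \<theta> ^ Suc p * of_real (g (Suc p) + 2 * (\<Sum>l = 1..p. g (Suc p - l) * cos (real l * \<theta>)))"
    by (simp only: sum_distrib_left[symmetric] of_real_sum[symmetric] of_real_add distrib_left mult.commute)
  finally show ?thesis .
qed

text \<open>The same pairing with opposite coefficients turns each pair into a factor -2 i sin (l
  \<theta>).\<close>

lemma sum_cis_odd: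
  assumes "\<And>l. l \<in> {1..p} \<Longrightarrow> g (Suc p + l) = - g (Suc p - l)" and "g (Suc p) = 0"
  shows "(\<Sum>k = 1..2 * p + 1. of_real (g k) * cis \<theta> ^ k)
    = cis \<theta> ^ Suc p * (\<i> * of_real (- 2 * (\<Sum>l = 1..p. g (Suc p - l) * sin (real l * \<theta>))))"
proof -
  have "of_real (g (Suc p - l)) * cis \<theta> ^ (Suc p - l) + of_real (g (Suc p + l)) * cis \<theta> ^ (Suc p + l)
      = cis \<theta> ^ Suc p * (\<i> * of_real (- 2 * (g (Suc p - l) * sin (real l * \<theta>))))" if "l \<in> {1..p}" for l
  proof -
    have "cis \<theta> ^ (Suc p - l) - cis \<theta> ^ (Suc p + l) = cis \<theta> ^ Suc p * (cis (- (real l * \<theta>)) - cis (real l * \<theta>))"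
      using that by (simp add: Complex.DeMoivre cis_mult algebra_simps del: power_Suc)
    also have "cis (- (real l * \<theta>)) - cis (real l * \<theta>) = \<i> * of_real (- 2 * sin (real l * \<theta>))"
      by (simp add: complex_eq_iff)
    finally show ?thesis
      using assms(1)[OF that] by (simp add: right_diff_distrib[symmetric] del: power_Suc)
  qed
  note * = this
  have "{1..2 * p + 1} = {Suc p - p..Suc p + p}"
    by auto
  then have "(\<Sum>k = 1..2 * p + 1. of_real (g k) * cis \<theta> ^ k) = of_real (g (Suc p)) * cis \<theta> ^ Suc p
      + (\<Sum>l = 1..p. of_real (g (Suc p - l)) * cis \<theta> ^ (Suc p - l) + of_real (g (Suc p + l)) * cis \<theta> ^ (Suc p + l))"
    using sum_symmetric_interval[of p "Suc p" "\<lambda>k. of_real (g k) * cis \<theta> ^ k"] by (simp only: le_SucI order_refl)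
  also have "\<dots> = 0 + (\<Sum>l = 1..p. cis \<theta> ^ Suc p * (\<i> * of_real (- 2 * (g (Suc p - l) * sin (real l * \<theta>)))))"
    by (intro arg_cong2[of _ _ _ _ "(+)"] sum.cong refl *) (simp add: assms(2))
  also have "\<dots> = cis \<theta> ^ Suc p * (\<i> * of_real (- 2 * (\<Sum>l = 1..p. g (Suc p - l) * sin (real l * \<theta>))))"
    by (simp only: sum_distrib_left[symmetric] of_real_sum[symmetric] add_0_left)
  finally show ?thesis .
qed

text \<open>Multiplying a generating polynomial by 1 - z takes backward differences of its
  coefficients; the zeros at both ends keep the summation range.\<close>

lemma sum_backward_difference:
  fixes z :: complex and g :: "real \<Rightarrow> real"
  assumes "g 0 = 0" "g (real N) = 0"
  shows "(\<Sum>k = 1..N. of_real (g (real k) - g (real k - 1)) * z ^ k) = (1 - z) * (\<Sum>k = 1..N. of_real (g (real k)) * z ^ k)"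
proof (cases N)
  case (Suc M)
  have "(\<Sum>k = 1..N. of_real (g (real k - 1)) * z ^ k) = (\<Sum>k = 0..M. of_real (g (real k)) * z ^ Suc k)"
    unfolding Suc One_nat_def sum.shift_bounds_cl_Suc_ivl by simp
  also have "\<dots> = z * (\<Sum>k = 0..M. of_real (g (real k)) * z ^ k)"
    by (simp add: sum_distrib_left mult_ac)
  also have "(\<Sum>k = 0..M. of_real (g (real k)) * z ^ k) = (\<Sum>k = 1..M. of_real (g (real k)) * z ^ k)"
    using assms(1) by (simp add: sum.atLeast_Suc_atMost)
  also have "\<dots> = (\<Sum>k = 1..N. of_real (g (real k)) * z ^ k)"
    using assms(2) by (simp add: Suc)
  finally show ?thesis
    by (simp add: left_diff_distrib sum_subtractf)
qed simp

text \<open>Padding with zeros beyond the support brings splines of different degrees to one common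
  range.\<close>

lemma exp_spline_eq_sum:
  assumes "0 < n" "n \<le> N"
  shows "exp_spline n z = (\<Sum>k = 1..N. of_real (bspline n (real k)) * z ^ k)"
proof -
  have "exp_spline n z = (\<Sum>k\<in>{1..n}. of_real (bspline n (real k)) * z ^ k)"
    unfolding exp_spline_def atMost_atLeast0 using assms(1)
    by (subst sum.atLeast_Suc_atMost) (simp_all add: bspline_0)
  also have "\<dots> = (\<Sum>k = 1..N. of_real (bspline n (real k)) * z ^ k)"
    using assms by (intro sum.mono_neutral_left) (auto simp: bspline_ge)
  finally show ?thesis .
qed

lemma exp_spline_sym_m:
  "exp_spline (2 * p + 1) (cis \<theta>) = cis \<theta> ^ Suc p * of_real (sym_m p \<theta>)"
proof -
  have "bspline (2 * p + 1) (real (Suc p + l)) = bspline (2 * p + 1) (real (Suc p - l))" if "l \<in> {1..p}" for l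
    using bspline_symmetric[of "2 * p + 1" "real (Suc p + l)"] that
    by (simp add: of_nat_diff algebra_simps del: bspline.simps)
  then have "(\<Sum>k = 1..2 * p + 1. of_real (bspline (2 * p + 1) (real k)) * cis \<theta> ^ k)
    = cis \<theta> ^ Suc p * of_real (bspline (2 * p + 1) (real (Suc p))
      + 2 * (\<Sum>l = 1..p. bspline (2 * p + 1) (real (Suc p - l)) * cos (real l * \<theta>)))"
    by (rule sum_cis_even)
  also have "\<dots> = cis \<theta> ^ Suc p * of_real (sym_m p \<theta>)"
    unfolding sym_m_def
    by (intro arg_cong2[of _ _ _ _ "(*)"] arg_cong[of _ _ of_real] arg_cong2[of _ _ _ _ "(+)"] sum.cong refl)
       (auto simp: of_nat_diff add_ac simp del: bspline.simps)
  finally show ?thesis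
    by (subst exp_spline_eq_sum[of _ "2 * p + 1"]) auto
qed

text \<open>The derivative of the spline is a backward difference in degree 2p, hence the factor 1 -
  z; it is odd about p + 1, hence the sine sum.\<close>

lemma exp_spline_sym_a:
  assumes "p \<ge> 1"
  shows "(1 - cis \<theta>) * exp_spline (2 * p) (cis \<theta>) = cis \<theta> ^ Suc p * (\<i> * of_real (sym_a p \<theta>))"
proof -
  define d where "d = deriv (bspline (2 * p + 1))"
  have d: "d t = bspline (2 * p) t - bspline (2 * p) (t - 1)" for t
    unfolding d_def using assms by (subst deriv_bspline) auto
  have sym: "d (2 * real p + 2 - t) = - d t" for t
    using bspline_symmetric[of "2 * p" t] bspline_symmetric[of "2 * p" "t - 1"] assms
    by (simp add: d algebra_simps)
  have "(1 - cis \<theta>) * exp_spline (2 * p) (cis \<theta>)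
      = (\<Sum>k = 1..2 * p + 1. of_real (d (real k)) * cis \<theta> ^ k)"
    unfolding d using assms
    by (subst sum_backward_difference, simp_all add: bspline_0 bspline_ge)
       (subst exp_spline_eq_sum[of _ "2 * p + 1"], simp_all add: bspline_ge of_nat_diff)
  also have "\<dots> = cis \<theta> ^ Suc p * (\<i> * of_real (- 2 * (\<Sum>l = 1..p. d (real (Suc p - l)) * sin (real l * \<theta>))))"
  proof (rule sum_cis_odd)
    show "d (real (Suc p + l)) = - d (real (Suc p - l))" if "l \<in> {1..p}" for l
      using sym[of "real (Suc p - l)"] that by (simp add: of_nat_diff algebra_simps)
    show "d (real (Suc p)) = 0"
      using sym[of "real (Suc p)"] by (simp add: algebra_simps)
  qed
  also have "\<dots> = cis \<theta> ^ Suc p * (\<i> * of_real (sym_a p \<theta>))"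
    unfolding sym_a_def d_def[symmetric]
    by (intro arg_cong2[of _ _ _ _ "(*)"] arg_cong[of _ _ of_real] sum.cong refl)
       (auto simp: of_nat_diff add_ac)
  finally show ?thesis .
qed

text \<open>Two differentiations are two backward differences, hence the square; the second
  derivative is again even about p + 1.\<close>

lemma exp_spline_sym_s:
  assumes "p \<ge> 1"
  shows "(1 - cis \<theta>)\<^sup>2 * exp_spline (2 * p - 1) (cis \<theta>) = - (cis \<theta> ^ Suc p * of_real (sym_s p \<theta>))"
proof -
  define e where "e = deriv (deriv (bspline (2 * p + 1)))"
  define d where "d t = bspline (2 * p - 1) t - bspline (2 * p - 1) (t - 1)" for t
  have e: "e t = d t - d (t - 1)" for t
    unfolding e_def d_def using assms by (subst deriv_deriv_bspline) auto
  have sym_d: "d (2 * real p + 1 - t) = - d t" for t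
    using bspline_symmetric[of "2 * p - 1" t] bspline_symmetric[of "2 * p - 1" "t - 1"] assms
    by (simp add: d_def algebra_simps of_nat_diff)
  have sym: "e (2 * real p + 2 - t) = e t" for t
    using sym_d[of t] sym_d[of "t - 1"] by (simp add: e algebra_simps)
  have "(1 - cis \<theta>) * ((1 - cis \<theta>) * exp_spline (2 * p - 1) (cis \<theta>))
      = (1 - cis \<theta>) * (\<Sum>k = 1..2 * p + 1. of_real (d (real k)) * cis \<theta> ^ k)"
    unfolding d_def using assms
    by (subst sum_backward_difference, simp_all add: bspline_0 bspline_ge of_nat_diff)
       (subst exp_spline_eq_sum[of _ "2 * p + 1"], simp_all add: bspline_ge of_nat_diff)
  also have "\<dots> = (\<Sum>k = 1..2 * p + 1. of_real (e (real k)) * cis \<theta> ^ k)"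
    unfolding e using assms
    by (subst sum_backward_difference, simp_all add: bspline_0 bspline_neg bspline_ge of_nat_diff d_def)
  also have "\<dots> = cis \<theta> ^ Suc p * of_real (e (real (Suc p)) + 2 * (\<Sum>l = 1..p. e (real (Suc p - l)) * cos (real l * \<theta>)))"
  proof (rule sum_cis_even)
    show "e (real (Suc p + l)) = e (real (Suc p - l))" if "l \<in> {1..p}" for l
      using sym[of "real (Suc p - l)"] that by (simp add: of_nat_diff algebra_simps)
  qed
  also have "e (real (Suc p)) + 2 * (\<Sum>l = 1..p. e (real (Suc p - l)) * cos (real l * \<theta>)) = - sym_s p \<theta>"
  proof -
    have "(\<Sum>l = 1..p. e (real (Suc p - l)) * cos (real l * \<theta>)) = (\<Sum>l = 1..p. e (real p + 1 - real l) * cos (real l * \<theta>))"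
      by (intro sum.cong refl) (auto simp: of_nat_diff add_ac)
    then show ?thesis
      unfolding sym_s_def e_def[symmetric] by (simp add: add_ac)
  qed
  finally show ?thesis
    by (simp add: power2_eq_square mult.assoc)
qed

text \<open>In all three cases the powers of 1 - z add up to 2p + 2, which produces the common
  factor K, while the powers of i cancel the alternating signs.\<close>

lemma sym_eq_lattice_sum:
  assumes "p \<ge> 1" "0 < x" "x < 1"
  defines "\<theta> \<equiv> 2 * pi * x"
  defines "K \<equiv> (2 - 2 * cos \<theta>) ^ (p + 1)" and "c \<equiv> 1 / (2 * pi)"
  shows "sym_m p \<theta> = K * c ^ (2 * p + 2) * lattice_sum (2 * p + 2) x"
    and "sym_a p \<theta> = - (K * c ^ (2 * p + 1) * lattice_sum (2 * p + 1) x)"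
    and "sym_s p \<theta> = K * c ^ (2 * p) * lattice_sum (2 * p) x"
proof -
  define z where "z = cis \<theta>"
  define I where "I n = (\<i> / (2 * of_real pi)) ^ n" for n
  have "exp (2 * of_real pi * \<i> * of_real x) \<noteq> 1"
    using assms(2,3) by (auto simp: exp_eq_1)
  then have "1 - z \<noteq> 0"
    by (simp add: z_def cis_conv_exp \<theta>_def mult_ac)
  then have E: "exp_spline n z = (1 - z) ^ Suc n * (I (Suc n) * of_real (lattice_sum (Suc n) x))" if "n > 0" for n
    using euler_quot_eq_lattice_sum[of x n] assms(2,3) that
    by (simp add: euler_quot_def z_def \<theta>_def I_def field_simps del: power_Suc)
  \<comment> \<open>On the unit circle the square is -z times |1 - z| squared, and the latter is the
    base of K.\<close>
  have "(1 - z)\<^sup>2 = - (z * of_real (2 - 2 * cos \<theta>))"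
  proof -
    have "z * of_real (2 * cos \<theta>) = z * z + z * cnj z"
      unfolding distrib_left[symmetric] by (simp add: z_def complex_eq_iff)
    also have "z * cnj z = 1"
      by (simp add: z_def cis_cnj cis_mult)
    finally show ?thesis
      by (simp add: power2_eq_square algebra_simps)
  qed
  then have Z: "(1 - z) ^ (2 * p + 2) = z ^ Suc p * ((-1) ^ Suc p * of_real K)"
    using power_mult[of "1 - z" 2 "p + 1"]
    by (simp add: power_minus[of "z * _"] power_mult_distrib K_def del: power_Suc)
  have z0: "z ^ Suc p \<noteq> 0"
    by (simp add: z_def)
  have "I 2 = of_real (- (c\<^sup>2))"
    by (simp add: I_def c_def power_divide)
  then have I: "I (2 * k) = of_real ((-1) ^ k * c ^ (2 * k))" for k
    by (simp add: I_def power_mult power_minus[of "of_real c ^ 2"])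
  have I1: "I (2 * k + 1) = \<i> * of_real ((-1) ^ k * c ^ (2 * k + 1))" for k
    using I[of k] by (simp add: I_def c_def)
  have "z ^ Suc p * of_real (sym_m p \<theta>) = (1 - z) ^ (2 * p + 2) * (I (2 * p + 2) * of_real (lattice_sum (2 * p + 2) x))"
    unfolding exp_spline_sym_m[of p \<theta>, folded z_def, symmetric] by (subst E) simp_all
  then have "complex_of_real (sym_m p \<theta>)
      = (-1) ^ Suc p * (of_real K * (I (2 * p + 2) * of_real (lattice_sum (2 * p + 2) x)))"
    unfolding Z mult.assoc mult_left_cancel[OF z0] .
  also have "\<dots> = of_real (K * c ^ (2 * p + 2) * lattice_sum (2 * p + 2) x)"
    using I[of "p + 1"] by (cases "even p") simp_all
  finally show "sym_m p \<theta> = K * c ^ (2 * p + 2) * lattice_sum (2 * p + 2) x"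
    by (simp only: of_real_eq_iff)
  have "z ^ Suc p * (\<i> * of_real (sym_a p \<theta>))
      = (1 - z) ^ (2 * p + 2) * (I (2 * p + 1) * of_real (lattice_sum (2 * p + 1) x))"
    unfolding exp_spline_sym_a[OF assms(1), of \<theta>, folded z_def, symmetric]
    using assms(1) by (subst E) simp_all
  then have "\<i> * complex_of_real (sym_a p \<theta>)
      = (-1) ^ Suc p * (of_real K * (I (2 * p + 1) * of_real (lattice_sum (2 * p + 1) x)))"
    unfolding Z mult.assoc mult_left_cancel[OF z0] .
  also have "\<dots> = \<i> * of_real (- (K * c ^ (2 * p + 1) * lattice_sum (2 * p + 1) x))"
    unfolding I1 by (cases "even p") simp_all
  finally show "sym_a p \<theta> = - (K * c ^ (2 * p + 1) * lattice_sum (2 * p + 1) x)"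
    by (simp only: of_real_eq_iff mult_cancel_left complex_i_not_zero simp_thms)
  have "z ^ Suc p * of_real (- sym_s p \<theta>) = (1 - z)\<^sup>2 * exp_spline (2 * p - 1) z"
    unfolding exp_spline_sym_s[OF assms(1), of \<theta>, folded z_def] by simp
  also have "\<dots> = (1 - z)\<^sup>2 * ((1 - z) ^ (2 * p) * (I (2 * p) * of_real (lattice_sum (2 * p) x)))"
    using E[of "2 * p - 1"] assms(1) by (simp add: Suc_diff_le)
  also have "\<dots> = (1 - z) ^ (2 * p + 2) * (I (2 * p) * of_real (lattice_sum (2 * p) x))"
    by (simp only: power_add mult_ac)
  finally have "complex_of_real (- sym_s p \<theta>)
      = (-1) ^ Suc p * (of_real K * (I (2 * p) * of_real (lattice_sum (2 * p) x)))"
    unfolding Z mult.assoc mult_left_cancel[OF z0] .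
  also have "\<dots> = of_real (- (K * c ^ (2 * p) * lattice_sum (2 * p) x))"
    unfolding I by (cases "even p") simp_all
  finally show "sym_s p \<theta> = K * c ^ (2 * p) * lattice_sum (2 * p) x"
    by (simp only: of_real_eq_iff neg_equal_iff_equal)
qed

section \<open>Bounds for the univariate symbols\<close>

lemma sym_parity:
  "sym_m p (- \<theta>) = sym_m p \<theta>" "sym_a p (- \<theta>) = - sym_a p \<theta>" "sym_s p (- \<theta>) = sym_s p \<theta>"
  by (simp_all add: sym_m_def sym_a_def sym_s_def sum_negf)

text \<open>The scaling factors agree, as c ^ (2p + 2) * c ^ (2p) is the square of c ^ (2p + 1), so
  Cauchy-Schwarz carries over from the lattice sums.\<close>

lemma sym_bounds_pos:
  assumes "p \<ge> 1" "0 < \<theta>" "\<theta> < 2 * pi"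
  shows "sym_m p \<theta> \<ge> 0" "sym_s p \<theta> \<ge> 0" "(sym_a p \<theta>)\<^sup>2 \<le> sym_m p \<theta> * sym_s p \<theta>"
proof -
  define x where "x = \<theta> / (2 * pi)"
  define K where "K = (2 - 2 * cos \<theta>) ^ (p + 1)"
  define c where "c = 1 / (2 * pi)"
  have x: "0 < x" "x < 1" "2 * pi * x = \<theta>"
    using assms by (auto simp: x_def)
  note eq = sym_eq_lattice_sum[OF assms(1) x(1,2), unfolded x(3), folded K_def c_def]
  have nonneg: "K \<ge> 0" "c \<ge> 0"
    by (auto simp: K_def c_def)
  show "sym_m p \<theta> \<ge> 0" "sym_s p \<theta> \<ge> 0"
    unfolding eq using assms(1) x nonneg by (auto intro!: mult_nonneg_nonneg lattice_sum_even_nonneg)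
  have "(K * c ^ (2 * p + 1))\<^sup>2 * (lattice_sum (2 * p + 1) x)\<^sup>2
      \<le> (K * c ^ (2 * p + 1))\<^sup>2 * (lattice_sum (2 * p + 2) x * lattice_sum (2 * p) x)"
    by (intro mult_left_mono lattice_sum_Cauchy_Schwarz x assms) simp
  then show "(sym_a p \<theta>)\<^sup>2 \<le> sym_m p \<theta> * sym_s p \<theta>"
    unfolding eq by (simp add: power2_eq_square mult_ac)
qed

lemma isCont_sym: "isCont (sym_m p) \<theta>" "isCont (sym_a p) \<theta>" "isCont (sym_s p) \<theta>"
  unfolding sym_m_def[abs_def] sym_a_def[abs_def] sym_s_def[abs_def]
  by (intro continuous_intros)+

lemma sym_bounds:
  assumes "p \<ge> 1" "\<theta> \<in> {-pi..pi}"
  shows "sym_m p \<theta> \<ge> 0 \<and> sym_s p \<theta> \<ge> 0 \<and> (sym_a p \<theta>)\<^sup>2 \<le> sym_m p \<theta> * sym_s p \<theta>"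
proof (cases \<theta> "0::real" rule: linorder_cases)
  case less
  then show ?thesis
    using sym_bounds_pos[OF assms(1), of "- \<theta>"] assms(2) by (simp add: sym_parity)
next
  case equal
  \<comment> \<open>At 0 the division by 1 - z breaks down; the bounds there are limits from the
    right.\<close>
  have ev: "\<forall>\<^sub>F t in at_right 0. 0 < t \<and> t < 2 * pi"
    using eventually_at_right_real[of 0 "2 * pi"] by simp
  have lim: "(f \<longlongrightarrow> f 0) (at_right 0)" if "isCont f 0" for f :: "real \<Rightarrow> real"
    using that unfolding isCont_def by (rule filterlim_mono) (auto intro: at_le)
  have "0 \<le> sym_m p 0" "0 \<le> sym_s p 0"
    by (rule tendsto_lowerbound[OF lim[OF isCont_sym(1)]] tendsto_lowerbound[OF lim[OF isCont_sym(3)]],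
        use ev in eventually_elim, use sym_bounds_pos[OF assms(1)] in simp, simp)+
  moreover have "(sym_a p 0)\<^sup>2 \<le> sym_m p 0 * sym_s p 0"
    by (rule tendsto_le[OF _ tendsto_mult[OF lim[OF isCont_sym(1)] lim[OF isCont_sym(3)]]
          tendsto_power[OF lim[OF isCont_sym(2)]]], simp,
        use ev in eventually_elim, use sym_bounds_pos[OF assms(1)] in simp)
  ultimately show ?thesis
    using equal by simp
next
  case greater
  then show ?thesis
    using sym_bounds_pos[OF assms(1), of \<theta>] assms(2) by auto
qed

subsection \<open>Eigenvalues of the symbol\<close>

text \<open>Trace and determinant are read off by comparing the coefficients of two forms of the
  characteristic polynomial.\<close>

lemma eig_sym_f:
  shows "eig_min (sym_f \<nu>1 \<nu>2 p \<alpha> \<beta> \<theta>1 \<theta>2) \<le> eig_max (sym_f \<nu>1 \<nu>2 p \<alpha> \<beta> \<theta>1 \<theta>2)"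
    and "eig_min (sym_f \<nu>1 \<nu>2 p \<alpha> \<beta> \<theta>1 \<theta>2) + eig_max (sym_f \<nu>1 \<nu>2 p \<alpha> \<beta> \<theta>1 \<theta>2)
      = sym_f11 \<nu>1 \<nu>2 p \<alpha> \<beta> \<theta>1 \<theta>2 + sym_f22 \<nu>1 \<nu>2 p \<alpha> \<beta> \<theta>1 \<theta>2"
    and "eig_min (sym_f \<nu>1 \<nu>2 p \<alpha> \<beta> \<theta>1 \<theta>2) * eig_max (sym_f \<nu>1 \<nu>2 p \<alpha> \<beta> \<theta>1 \<theta>2)
      = sym_f11 \<nu>1 \<nu>2 p \<alpha> \<beta> \<theta>1 \<theta>2 * sym_f22 \<nu>1 \<nu>2 p \<alpha> \<beta> \<theta>1 \<theta>2 - (sym_f12 p \<alpha> \<beta> \<theta>1 \<theta>2)\<^sup>2"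
proof -
  define A where "A = sym_f \<nu>1 \<nu>2 p \<alpha> \<beta> \<theta>1 \<theta>2"
  define l u where "l = eig_min A" and "u = eig_max A"
  define a b d where "a = sym_f11 \<nu>1 \<nu>2 p \<alpha> \<beta> \<theta>1 \<theta>2"
    and "b = sym_f12 p \<alpha> \<beta> \<theta>1 \<theta>2" and "d = sym_f22 \<nu>1 \<nu>2 p \<alpha> \<beta> \<theta>1 \<theta>2"
  note cp = char_poly_sym_f[of \<nu>1 \<nu>2 p \<alpha> \<beta> \<theta>1 \<theta>2, folded A_def, folded l_def u_def]
  have A: "A \<in> carrier_mat 2 2"
    unfolding A_def by (rule sym_f_carrier)
  have "real_eigenvalues A = {l, u}"
    unfolding real_eigenvalues_def eigenvalue_root_char_poly[OF A] cp poly_mult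
    by (auto simp del: mult_pCons_left mult_pCons_right)
  then show "eig_min A \<le> eig_max A"
    by (simp add: eig_min_def eig_max_def)
  have "char_poly A = [:of_real (a * d - b * b), - of_real (a + d), 1:]"
    using A unfolding char_poly_defs A_def sym_f_def a_def[symmetric] b_def[symmetric] d_def[symmetric]
    by (subst det_mat_2) (auto simp: mat_of_rows_list_def)
  moreover have "char_poly A = [:of_real (l * u), - of_real (l + u), 1:]"
    unfolding cp by simp
  ultimately have "complex_of_real (l + u) = of_real (a + d)" "complex_of_real (l * u) = of_real (a * d - b * b)"
    by (simp_all del: of_real_add of_real_mult of_real_diff)
  then show "l + u = a + d" "l * u = a * d - b\<^sup>2"
    by (simp_all only: of_real_eq_iff power2_eq_square)
qed

lemma nonneg_if_sum_prod_nonneg: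
  fixes x y :: real
  assumes "x + y \<ge> 0" "x * y \<ge> 0"
  shows "x \<ge> 0"
  using assms by (auto simp: zero_le_mult_iff)

theorem theorem5p2:
  fixes p :: nat and \<alpha> \<beta> \<nu>1 \<nu>2 :: real
  assumes "p \<ge> 1"
    and "\<alpha> \<ge> 0" and "\<beta> \<ge> 0"
    and "\<nu>1 \<in> \<rat>" and "\<nu>1 > 0" and "\<nu>2 \<in> \<rat>" and "\<nu>2 > 0"
  shows "\<forall>\<theta>1 \<in> {-pi..pi}. \<forall>\<theta>2 \<in> {-pi..pi}.
      0 \<le> min \<alpha> \<beta> * laplace_sym \<nu>1 \<nu>2 p \<theta>1 \<theta>2
    \<and> min \<alpha> \<beta> * laplace_sym \<nu>1 \<nu>2 p \<theta>1 \<theta>2 \<le> eig_min (sym_f \<nu>1 \<nu>2 p \<alpha> \<beta> \<theta>1 \<theta>2)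
    \<and> eig_min (sym_f \<nu>1 \<nu>2 p \<alpha> \<beta> \<theta>1 \<theta>2) \<le> eig_max (sym_f \<nu>1 \<nu>2 p \<alpha> \<beta> \<theta>1 \<theta>2)
    \<and> eig_max (sym_f \<nu>1 \<nu>2 p \<alpha> \<beta> \<theta>1 \<theta>2) \<le> max \<alpha> \<beta> * laplace_sym \<nu>1 \<nu>2 p \<theta>1 \<theta>2"
proof (intro ballI)
  fix \<theta>1 \<theta>2
  assume \<theta>: "\<theta>1 \<in> {-pi..pi}" "\<theta>2 \<in> {-pi..pi}"
  define l u where "l = eig_min (sym_f \<nu>1 \<nu>2 p \<alpha> \<beta> \<theta>1 \<theta>2)" and "u = eig_max (sym_f \<nu>1 \<nu>2 p \<alpha> \<beta> \<theta>1 \<theta>2)"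
  define X Y where "X = \<nu>2 / \<nu>1 * sym_m p \<theta>1 * sym_s p \<theta>2" and "Y = \<nu>1 / \<nu>2 * sym_s p \<theta>1 * sym_m p \<theta>2"
  define C where "C = sym_a p \<theta>1 * sym_a p \<theta>2"
  note b1 = sym_bounds[OF assms(1) \<theta>(1)] and b2 = sym_bounds[OF assms(1) \<theta>(2)]
  have XY: "X \<ge> 0" "Y \<ge> 0"
    using b1 b2 assms by (auto simp: X_def Y_def)
  \<comment> \<open>Multiply the two univariate bounds; the ratios of \<nu>1 and \<nu>2 cancel in X
    * Y.\<close>
  have "C\<^sup>2 \<le> (sym_m p \<theta>1 * sym_s p \<theta>1) * (sym_m p \<theta>2 * sym_s p \<theta>2)"
    unfolding C_def power_mult_distrib using b1 b2 by (intro mult_mono) auto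
  also have "\<dots> = X * Y"
    using assms by (simp add: X_def Y_def)
  finally have C: "C\<^sup>2 \<le> X * Y" .
  have L: "laplace_sym \<nu>1 \<nu>2 p \<theta>1 \<theta>2 = X + Y"
    by (simp add: laplace_sym_def X_def Y_def)
  have f: "sym_f11 \<nu>1 \<nu>2 p \<alpha> \<beta> \<theta>1 \<theta>2 = \<alpha> * X + \<beta> * Y" "sym_f22 \<nu>1 \<nu>2 p \<alpha> \<beta> \<theta>1 \<theta>2 = \<alpha> * Y + \<beta> * X"
    "sym_f12 p \<alpha> \<beta> \<theta>1 \<theta>2 = - (\<alpha> - \<beta>) * C"
    by (simp_all add: sym_f11_def sym_f22_def sym_f12_def X_def Y_def C_def)
  note eig = eig_sym_f[of \<nu>1 \<nu>2 p \<alpha> \<beta> \<theta>1 \<theta>2, folded l_def u_def, unfolded f]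
  define \<mu> where "\<mu> = min \<alpha> \<beta>"
  have sum: "l + u = (min \<alpha> \<beta> + max \<alpha> \<beta>) * (X + Y)"
    using eig(2) by (simp add: min_def max_def algebra_simps)
  \<comment> \<open>This is the trace of f - \<mu> L, written through its eigenvalues.\<close>
  have diff_sum: "(l - \<mu> * (X + Y)) + (u - \<mu> * (X + Y)) = (max \<alpha> \<beta> - \<mu>) * (X + Y)"
    using sum by (simp add: \<mu>_def algebra_simps)
  \<comment> \<open>This is its determinant: the diagonal entries are |\<alpha> - \<beta>| X and
    |\<alpha> - \<beta>| Y in some order.\<close>
  have diff_prod: "(l - \<mu> * (X + Y)) * (u - \<mu> * (X + Y)) = (\<alpha> - \<beta>)\<^sup>2 * (X * Y - C\<^sup>2)"
  proof -
    have "(l - \<mu> * (X + Y)) * (u - \<mu> * (X + Y)) = l * u - \<mu> * (X + Y) * (l + u) + (\<mu> * (X + Y))\<^sup>2"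
      by (simp add: power2_eq_square algebra_simps)
    also have "\<dots> = (\<alpha> - \<beta>)\<^sup>2 * (X * Y - C\<^sup>2)"
      unfolding eig by (cases "\<alpha> \<le> \<beta>") (simp_all add: \<mu>_def power2_eq_square algebra_simps)
    finally show ?thesis .
  qed
  have "l - \<mu> * (X + Y) \<ge> 0"
  proof (rule nonneg_if_sum_prod_nonneg)
    show "(l - \<mu> * (X + Y)) + (u - \<mu> * (X + Y)) \<ge> 0"
      unfolding diff_sum using XY by (intro mult_nonneg_nonneg) (auto simp: \<mu>_def)
    show "(l - \<mu> * (X + Y)) * (u - \<mu> * (X + Y)) \<ge> 0"
      unfolding diff_prod using C by (intro mult_nonneg_nonneg) auto
  qed
  moreover have "0 \<le> \<mu> * (X + Y)"
    using assms XY by (simp add: \<mu>_def)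
  \<comment> \<open>Since the trace is (min + max) L, the lower bound for l is at the same time the
    upper bound for u.\<close>
  moreover have "l + u = \<mu> * (X + Y) + max \<alpha> \<beta> * (X + Y)"
    unfolding sum \<mu>_def by (rule distrib_right)
  ultimately show "0 \<le> min \<alpha> \<beta> * laplace_sym \<nu>1 \<nu>2 p \<theta>1 \<theta>2
    \<and> min \<alpha> \<beta> * laplace_sym \<nu>1 \<nu>2 p \<theta>1 \<theta>2 \<le> l \<and> l \<le> u \<and> u \<le> max \<alpha> \<beta> * laplace_sym \<nu>1 \<nu>2 p \<theta>1 \<theta>2"
    unfolding L \<mu>_def using eig(1) by linarith
qed

end
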